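(* Let $X$ be a separable complete metric space with metric $\rho\le 1$, and let $S(t_0,a)$, $t_0\in[0,+\infty)$, $a\in X$, be a family of abstract local integral funnels with terminal times $T(t_0,a)$ (as defined in the context). Then the family has a selection $\mathfrak{u}(\cdot;t_0,a)\in S(t_0,a)$, $t_0\ge 0$, $a\in X$, with the following properties. a) For every $t_0\ge 0$, the map $X\ni a\mapsto \mathfrak{u}(\cdot;t_0,a)\in C([t_0,t_0+T(t_0,a))\to X)$ is measurable (in the re-parametrized sense described in the context). b) $\mathfrak{u}(t_0;t_0,a)=a$ for all $t_0\ge 0$, $a\in X$. c) $\mathfrak{u}(t_2;t_1,\mathfrak{u}(t_1;t_0,a))=\mathfrak{u}(t_2;t_0,a)$ for all $t_0\ge 0$, $a\in X$, $t_1\in[t_0,t_0+T(t_0,a))$ and $t_2\in[t_1,t_0+T(t_0,a))$.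
   Context: $X$ is a separable complete metric space with metric $\rho$, assumed bounded: $\rho(x,y)\le 1$ for all $x,y\in X$; $\mathcal{B}_X$ is its Borel $\sigma$-algebra. $C(I\to X)$ denotes the space of continuous maps from an interval $I$ to $X$. Let $\tilde\Omega=C([0,1)\to X)$ with the compact-open topology and its Borel $\sigma$-algebra. To every $t_0\in[0,+\infty)$ and $a\in X$ there correspond a strictly positive (finite) real number $T(t_0,a)$, the terminal time, and a set $S(t_0,a)\subset C([t_0,t_0+T(t_0,a))\to X)$. Shift: for $u\in S(t_0,a)$ and $0\le\tau<T(t_0,a)$, $\sigma_\tau u$ is the restriction of $u$ to $[t_0+\tau,t_0+T(t_0,a))$. Splicing: for $u\in S(t_0,a)$, $0\le\tau<T(t_0,a)$ and $v\in S(t_0+\tau,u(t_0+\tau))$, the spliced path $w=u\underset{t_0+\tau}{\bowtie}v$ is given by $w(t)=u(t)$ for $t_0\le t\le t_0+\tau$ and $w(t)=v(t)$ for $t_0+\tau\le t<t_0+T(t_0,a)$. Re-parametrization: for $w\in C([t_0,t_0+T(t_0,a))\to X)$, define $\tilde w\in\tilde\Omega$ by $\tilde w(s)=w(t_0+s\,T(t_0,a))$, $s\in[0,1)$; put $\tilde S(t_0,a)=\{\tilde w: w\in S(t_0,a)\}$. The family $S(t_0,a)$ is called a family of abstract local integral funnels with terminal times $T(t_0,a)$ if: (TT) $T$ is lower semi-continuous on $[0,+\infty)\times X$: if $(t_n,a_n)\to(t_0,a)$, then $T(t_0,a)\le\liminf T(t_n,a_n)$. (LS1) Every $S(t_0,a)$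 is a non-empty compact subset of $C([t_0,t_0+T(t_0,a))\to X)$ with the topology of uniform convergence on every closed subinterval $[\alpha,\beta]$ of $[t_0,t_0+T(t_0,a))$. Every path $w=w(\cdot;t_0,a)\in S(t_0,a)$ satisfies $w(t_0;t_0,a)=a$. (LS2) For every $t_0\ge 0$ the map $a\mapsto S(t_0,a)$ is measurable in the sense that for every closed $F\subset\tilde\Omega$, $\{a\in X:\tilde S(t_0,a)\cap F\ne\emptyset\}\in\mathcal{B}_X$. (LS3) If $u\in S(t_0,a)$ and $0\le\tau<T(t_0,a)$, then $T(t_0+\tau,u(t_0+\tau;t_0,a))\ge T(t_0,a)-\tau$ and $\sigma_\tau u\in S(t_0+\tau,u(t_0+\tau;t_0,a))$. (Membership is literal, as an element of a set of functions with domain $[t_0+\tau,\,t_0+\tau+T(t_0+\tau,u(t_0+\tau;t_0,a)))$; in particular the domains coincide.) (LS4) If $u\in S(t_0,a)$, $0\le\tau<T(t_0,a)$ and $v\in S(t_0+\tau,u(t_0+\tau;t_0,a))$, then the spliced path $u\underset{t_0+\tau}{\bowtie}v$ belongs to $S(t_0,a)$. Measurability of a selection: for fixed $t_0$, a single-valued map $a\mapsto w_a\in C([t_0,t_0+T(t_0,a))\to X)$ is called measurable if the map $X\to\tilde\Omega$, $a\mapsto\tilde w_a$, is Borel measurable. *)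

theory Defs
  imports "HOL-Analysis.Analysis"
begin

text \<open>
  A path on a time interval \<open>I\<close> is a partial function with domain exactly \<open>I\<close>, so that the
  domain is part of the path: equality of paths, and membership in a set of paths, includes
  equality of the domains.
\<close>

type_synonym 'a path = "real \<rightharpoonup> 'a"

definition paths :: "real set \<Rightarrow> 'a::topological_space path set" where
  "paths I = {w. dom w = I \<and> continuous_on I (\<lambda>t. the (w t))}"

definition compact_open_topology :: "real set \<Rightarrow> 'a::topological_space path topology" where
  "compact_open_topology I = topology_generated_by
     {{w \<in> paths I. \<forall>t\<in>K. the (w t) \<in> U} | K U. compact K \<and> K \<subseteq> I \<and> open U}"

definition locally_uniform_topology :: "real set \<Rightarrow> 'a::metric_space path topology" where
  "locally_uniform_topology I = topology_generated_by
     {{w \<in> paths I. \<forall>t\<in>{\<alpha>..\<beta>}. dist (the (v t)) (the (w t)) < \<epsilon>} | v \<alpha> \<beta> \<epsilon>.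
        v \<in> paths I \<and> {\<alpha>..\<beta>} \<subseteq> I \<and> 0 < \<epsilon>}"

lemma topspace_compact_open_topology [simp]: "topspace (compact_open_topology I) = paths I"
proof
  show "topspace (compact_open_topology I) \<subseteq> (paths I :: 'a path set)"
    unfolding compact_open_topology_def topology_generated_by_topspace by blast
  have "compact {} \<and> {} \<subseteq> I \<and> open (UNIV :: 'a set)
      \<and> paths I = {w \<in> paths I. \<forall>t\<in>{}. the (w t) \<in> (UNIV :: 'a set)}"
    by simp
  then show "(paths I :: 'a path set) \<subseteq> topspace (compact_open_topology I)"
    unfolding compact_open_topology_def topology_generated_by_topspace by blast
qed

lemma topspace_locally_uniform_topology [simp]:
  "topspace (locally_uniform_topology I) = paths I"
proof
  show "topspace (locally_uniform_topology I) \<subseteq> (paths I :: 'a path set)"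
    unfolding locally_uniform_topology_def topology_generated_by_topspace by blast
  show "(paths I :: 'a path set) \<subseteq> topspace (locally_uniform_topology I)"
  proof
    fix v :: "'a path" assume v: "v \<in> paths I"
    let ?B = "{w \<in> paths I. \<forall>t\<in>{1..0}. dist (the (v t)) (the (w t)) < 1}"
    have "v \<in> ?B" using v by simp
    moreover have "v \<in> paths I \<and> {1..0::real} \<subseteq> I \<and> 0 < (1::real)" using v by simp
    ultimately show "v \<in> topspace (locally_uniform_topology I)"
      unfolding locally_uniform_topology_def topology_generated_by_topspace by blast
  qed
qed

text \<open>The path space \<open>C([0,1) \<rightarrow> X)\<close> with its Borel \<open>\<sigma>\<close>-algebra.\<close>

abbreviation unit_path_topology :: "'a::topological_space path topology" where
  "unit_path_topology \<equiv> compact_open_topology {0..<1}"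

definition unit_path_borel :: "'a::topological_space path measure" where
  "unit_path_borel =
     sigma (topspace unit_path_topology) {U. openin unit_path_topology U}"

definition reparam :: "real \<Rightarrow> real \<Rightarrow> 'a path \<Rightarrow> 'a path" where
  "reparam t0 L w = (\<lambda>s. if s \<in> {0..<1} then w (t0 + s * L) else None)"

definition splice :: "'a path \<Rightarrow> real \<Rightarrow> 'a path \<Rightarrow> 'a path" where
  "splice u t1 v = (\<lambda>t. if t \<le> t1 then u t else v t)"

text \<open>
  Only initial times \<open>t0 \<ge> 0\<close> are constrained; the values of \<open>T\<close> and \<open>S\<close> at negative times are
  irrelevant.  In \<open>LS3\<close> the path \<open>\<sigma>\<^sub>\<tau> u\<close> is the restriction of \<open>u\<close> to \<open>[t0 + \<tau>, t0 + T t0 a)\<close>; its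
  membership in \<open>S (t0 + \<tau>) (u (t0 + \<tau>))\<close> forces \<open>T (t0 + \<tau>) (u (t0 + \<tau>)) = T t0 a - \<tau>\<close>.
  Hence in \<open>LS4\<close> the spliced path has domain \<open>[t0, t0 + T t0 a)\<close>.
\<close>

locale abstract_local_integral_funnels =
  fixes T :: "real \<Rightarrow> 'a::polish_space \<Rightarrow> real"
    and S :: "real \<Rightarrow> 'a \<Rightarrow> 'a path set"
  assumes T_pos: "0 \<le> t0 \<Longrightarrow> 0 < T t0 a"
    and S_paths: "0 \<le> t0 \<Longrightarrow> S t0 a \<subseteq> paths {t0..<t0 + T t0 a}"
    and TT: "\<lbrakk>\<And>n. 0 \<le> t n; 0 \<le> t0; (\<lambda>n. (t n, x n)) \<longlonglongrightarrow> (t0, a)\<rbrakk>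
      \<Longrightarrow> ereal (T t0 a) \<le> liminf (\<lambda>n. ereal (T (t n) (x n)))"
    and LS1_nonempty: "0 \<le> t0 \<Longrightarrow> S t0 a \<noteq> {}"
    and LS1_compact:
      "0 \<le> t0 \<Longrightarrow> compactin (locally_uniform_topology {t0..<t0 + T t0 a}) (S t0 a)"
    and LS1_initial: "\<lbrakk>0 \<le> t0; w \<in> S t0 a\<rbrakk> \<Longrightarrow> w t0 = Some a"
    and LS2: "\<lbrakk>0 \<le> t0; closedin unit_path_topology F\<rbrakk>
      \<Longrightarrow> {a. reparam t0 (T t0 a) ` S t0 a \<inter> F \<noteq> {}} \<in> sets borel"
    and LS3_time: "\<lbrakk>0 \<le> t0; u \<in> S t0 a; 0 \<le> \<tau>; \<tau> < T t0 a\<rbrakk>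
      \<Longrightarrow> T t0 a - \<tau> \<le> T (t0 + \<tau>) (the (u (t0 + \<tau>)))"
    and LS3_shift: "\<lbrakk>0 \<le> t0; u \<in> S t0 a; 0 \<le> \<tau>; \<tau> < T t0 a\<rbrakk>
      \<Longrightarrow> u |` {t0 + \<tau>..<t0 + T t0 a} \<in> S (t0 + \<tau>) (the (u (t0 + \<tau>)))"
    and LS4: "\<lbrakk>0 \<le> t0; u \<in> S t0 a; 0 \<le> \<tau>; \<tau> < T t0 a; v \<in> S (t0 + \<tau>) (the (u (t0 + \<tau>)))\<rbrakk>
      \<Longrightarrow> splice u (t0 + \<tau>) v \<in> S t0 a"

end

theory Submission
  imports Defs
begin

text \<open>
  Instead of minimising integral functionals, the funnels are shrunk by yes/no questions.  For a
  time \<open>q\<close> and a closed set \<open>B\<close>, keep only the paths that are in \<open>B\<close> at time \<open>q\<close>, provided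
  there are any; otherwise keep the whole funnel.  The answer depends only on the absolute time
  \<open>q\<close>, so it is compatible with shifting and splicing, and the refined family is again a family
  of funnels.  Asking all questions with \<open>q\<close> rational and \<open>-B\<close> in a countable basis, one after
  the other, gives decreasing compact sets whose intersection is a single path; the shift property
  of the refined families then is the semigroup property of the selection.
\<close>

subsection \<open>Topologies on path spaces\<close>

text \<open>The image of \<open>K\<close> is compact, so it has a uniform margin inside
  \<open>U\<close>; enclosing \<open>K\<close> between its least and greatest element turns this
  margin into a generator of the locally uniform topology.\<close>

lemma openin_locally_uniform_maps_into:
  fixes U :: "'a::metric_space set"
  assumes "compact K" "K \<subseteq> {c..<d}" "open U"
  shows "openin (locally_uniform_topology {c..<d})
    {w \<in> paths {c..<d}. \<forall>t\<in>K. the (w t) \<in> U}"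
proof (cases "K = {}")
  case True
  then show ?thesis
    using openin_topspace[of "locally_uniform_topology {c..<d} :: 'a path topology"] by simp
next
  case False
  let ?I = "{c..<d}"
  obtain \<alpha> where \<alpha>: "\<alpha> \<in> K" "\<And>t. t \<in> K \<Longrightarrow> \<alpha> \<le> t"
    using compact_attains_inf[OF assms(1) False] by blast
  obtain \<beta> where \<beta>: "\<beta> \<in> K" "\<And>t. t \<in> K \<Longrightarrow> t \<le> \<beta>"
    using compact_attains_sup[OF assms(1) False] by blast
  have sub: "{\<alpha>..\<beta>} \<subseteq> ?I" using \<alpha> \<beta> assms(2) by fastforce
  show ?thesis
  proof (subst openin_subopen, intro ballI)
    fix w assume "w \<in> {w \<in> paths ?I. \<forall>t\<in>K. the (w t) \<in> U}"
    then have w: "w \<in> paths ?I" and wU: "(\<lambda>t. the (w t)) ` K \<subseteq> U" by auto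
    have "compact ((\<lambda>t. the (w t)) ` K)"
      using w assms(1,2) unfolding paths_def
      by (auto intro!: compact_continuous_image intro: continuous_on_subset)
    then obtain e where e: "e > 0" "(\<Union>x\<in>(\<lambda>t. the (w t)) ` K. ball x e) \<subseteq> U"
      using compact_subset_open_imp_ball_epsilon_subset[OF _ assms(3) wU] by metis
    let ?N = "{w' \<in> paths ?I. \<forall>t\<in>{\<alpha>..\<beta>}. dist (the (w t)) (the (w' t)) < e}"
    have "openin (locally_uniform_topology ?I) ?N"
      unfolding locally_uniform_topology_def
      by (rule topology_generated_by_Basis) (use w e(1) sub in blast)
    moreover have "w \<in> ?N" using w e(1) by simp
    moreover have "?N \<subseteq> {w \<in> paths ?I. \<forall>t\<in>K. the (w t) \<in> U}"
      using e(2) \<alpha>(2) \<beta>(2) by (fastforce simp: mem_ball)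
    ultimately show "\<exists>N. openin (locally_uniform_topology ?I) N \<and> w \<in> N
        \<and> N \<subseteq> {w \<in> paths ?I. \<forall>t\<in>K. the (w t) \<in> U}" by blast
  qed
qed

lemma closedin_locally_uniform_eval:
  fixes B :: "'a::metric_space set"
  assumes "q \<in> {c..<d}" "closed B"
  shows "closedin (locally_uniform_topology {c..<d}) {w \<in> paths {c..<d}. the (w q) \<in> B}"
proof -
  have "openin (locally_uniform_topology {c..<d})
      {w \<in> paths {c..<d}. \<forall>t\<in>{q}. the (w t) \<in> - B}"
    by (rule openin_locally_uniform_maps_into) (use assms in auto)
  moreover have "paths {c..<d} - {w \<in> paths {c..<d}. the (w q) \<in> B}
      = {w \<in> paths {c..<d}. \<forall>t\<in>{q}. the (w t) \<in> - B}" by auto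
  ultimately show ?thesis unfolding closedin_def by auto
qed

lemma path_ext:
  assumes "u \<in> paths I" "v \<in> paths I" "\<And>t. t \<in> I \<Longrightarrow> the (u t) = the (v t)"
  shows "u = v"
proof
  fix t show "u t = v t"
    using assms unfolding paths_def by (cases "t \<in> I") (force simp: domIff)+
qed

text \<open>Evaluation at a time of disagreement separates two paths. The purpose is that compact
  funnels become closed sets.\<close>

lemma Hausdorff_locally_uniform_topology:
  "Hausdorff_space (locally_uniform_topology {c..<d} :: 'a::metric_space path topology)"
  unfolding Hausdorff_space_def
proof clarsimp
  fix u v :: "'a path"
  let ?I = "{c..<d}"
  assume uv: "u \<in> paths ?I" "v \<in> paths ?I" "u \<noteq> v"
  then obtain t where t: "t \<in> ?I" "the (u t) \<noteq> the (v t)" using path_ext by metis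
  obtain U V where UV: "open U" "open V" "the (u t) \<in> U" "the (v t) \<in> V" "U \<inter> V = {}"
    using hausdorff[OF t(2)] by blast
  have *: "openin (locally_uniform_topology ?I) {w \<in> paths ?I. \<forall>s\<in>{t}. the (w s) \<in> W}"
    if "open W" for W :: "'a set"
    by (rule openin_locally_uniform_maps_into) (use t that in auto)
  show "\<exists>U. openin (locally_uniform_topology ?I) U \<and>
      (\<exists>V. openin (locally_uniform_topology ?I) V \<and> u \<in> U \<and> v \<in> V \<and> disjnt U V)"
  proof (intro exI conjI)
    show "disjnt {w \<in> paths ?I. \<forall>s\<in>{t}. the (w s) \<in> U} {w \<in> paths ?I. \<forall>s\<in>{t}. the (w s) \<in> V}"
      using UV(5) by (auto simp: disjnt_iff)
  qed (use *[OF UV(1)] *[OF UV(2)] UV(3,4) uv(1,2) in auto)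
qed

section \<open>Reparametrization to the unit interval\<close>

lemma reparam_in_paths:
  assumes "0 < L" "w \<in> paths {t0..<t0 + L}"
  shows "reparam t0 L w \<in> paths {0..<1}"
proof -
  have w: "dom w = {t0..<t0 + L}" "continuous_on {t0..<t0 + L} (\<lambda>t. the (w t))"
    using assms(2) by (auto simp: paths_def)
  have in_I: "t0 + s * L \<in> {t0..<t0 + L} \<longleftrightarrow> s \<in> {0..<1}" for s
    using assms(1) by (auto simp: zero_le_mult_iff mult_less_cancel_right1)
  have "s \<in> dom (reparam t0 L w) \<longleftrightarrow> s \<in> {0..<1}" for s
    using in_I[of s] w(1) unfolding domIff reparam_def by (metis domIff)
  then have "dom (reparam t0 L w) = {0..<1}" by blast
  moreover have "continuous_on {0..<1} (\<lambda>s. the (w (t0 + s * L)))"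
  proof (rule continuous_on_compose2[OF w(2)])
    show "continuous_on {0..<1} (\<lambda>s. t0 + s * L)" by (intro continuous_intros)
    show "(\<lambda>s. t0 + s * L) ` {0..<1} \<subseteq> {t0..<t0 + L}" using in_I by blast
  qed
  then have "continuous_on {0..<1} (\<lambda>s. the (reparam t0 L w s))"
    by (rule continuous_on_eq) (simp add: reparam_def)
  ultimately show ?thesis by (simp add: paths_def)
qed

text \<open>The affine time change sends compact subsets of \<open>[0,1)\<close> to compact subsets
  of the original interval, so generators pull back to open sets. This carries compactness of the
  funnels to the unit path space, where \<open>LS2\<close> is formulated.\<close>

lemma continuous_map_reparam:
  assumes "0 < L"
  shows "continuous_map (locally_uniform_topology {t0..<t0 + L})
    (unit_path_topology :: 'a::metric_space path topology) (reparam t0 L)"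
  unfolding compact_open_topology_def
proof (rule continuous_on_generated_topo)
  let ?I = "{t0..<t0 + L}"
  fix W :: "'a path set"
  assume "W \<in> {{w \<in> paths {0..<1}. \<forall>t\<in>K. the (w t) \<in> U} |K U.
      compact K \<and> K \<subseteq> {0..<1} \<and> open U}"
  then obtain K U where W: "W = {w \<in> paths {0..<1}. \<forall>t\<in>K. the (w t) \<in> U}"
    and K: "compact K" "K \<subseteq> {0..<1}" "open U" by auto
  have "(\<lambda>s. t0 + s * L) ` K \<subseteq> ?I"
    using K(2) assms by (auto simp: subset_iff mult_less_cancel_right1)
  moreover have "compact ((\<lambda>s. t0 + s * L) ` K)"
    by (intro compact_continuous_image continuous_intros K)
  ultimately have "openin (locally_uniform_topology ?I)
      {w \<in> paths ?I. \<forall>t\<in>(\<lambda>s. t0 + s * L) ` K. the (w t) \<in> U}"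
    using K(3) openin_locally_uniform_maps_into by blast
  moreover have "reparam t0 L -` W \<inter> topspace (locally_uniform_topology ?I)
      = {w \<in> paths ?I. \<forall>t\<in>(\<lambda>s. t0 + s * L) ` K. the (w t) \<in> U}"
    using K(2) reparam_in_paths[OF assms] unfolding W by (fastforce simp: reparam_def subset_iff)
  ultimately show "openin (locally_uniform_topology ?I)
      (reparam t0 L -` W \<inter> topspace (locally_uniform_topology ?I))" by simp
next
  have "paths {0..<1} = topspace (unit_path_topology :: 'a path topology)" by simp
  then show "reparam t0 L ` topspace (locally_uniform_topology {t0..<t0 + L})
      \<subseteq> \<Union> {{w \<in> paths {0..<1}. \<forall>t\<in>K. the (w t) \<in> U} |K U.
          compact K \<and> K \<subseteq> {0..<1} \<and> open (U :: 'a set)}"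
    using reparam_in_paths[OF assms]
    unfolding compact_open_topology_def topology_generated_by_topspace by auto
qed

lemma reparam_eq:
  assumes "0 < L" "t \<in> {t0..<t0 + L}"
  shows "reparam t0 L w ((t - t0) / L) = w t"
  using assms by (auto simp: reparam_def field_simps)

section \<open>Closed conditions on paths and compactness arguments\<close>

lemma closedin_compact_open_meets:
  fixes B :: "'a::topological_space set"
  assumes "compact K" "K \<subseteq> I" "closed B"
  shows "closedin (compact_open_topology I) {w \<in> paths I. \<exists>t\<in>K. the (w t) \<in> B}"
proof -
  have "openin (compact_open_topology I) {w \<in> paths I. \<forall>t\<in>K. the (w t) \<in> - B}"
    unfolding compact_open_topology_def
    by (rule topology_generated_by_Basis) (use assms in blast)
  moreover have "paths I - {w \<in> paths I. \<exists>t\<in>K. the (w t) \<in> B}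
      = {w \<in> paths I. \<forall>t\<in>K. the (w t) \<in> - B}" by auto
  ultimately show ?thesis unfolding closedin_def by auto
qed

lemma compactin_decseq_meets:
  fixes C :: "nat \<Rightarrow> 'b set"
  assumes "compactin X K" "\<And>n. closedin X (C n)" "decseq C" "\<And>n. K \<inter> C n \<noteq> {}"
  obtains w where "w \<in> K" "\<And>n. w \<in> C n"
proof -
  have "(\<Inter>n. K \<inter> C n) \<noteq> {}"
  proof (rule compact_space_imp_nest)
    show "compact_space (subtopology X K)" using assms(1) by (simp add: compact_space_subtopology)
    show "closedin (subtopology X K) (K \<inter> C n)" for n
      using assms(2) by (rule closedin_subtopology_Int_closed)
    show "K \<inter> C n \<noteq> {}" for n by (rule assms(4))
    show "decseq (\<lambda>n. K \<inter> C n)" using assms(3) by (auto simp: decseq_def)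
  qed
  then show ?thesis using that by blast
qed

text \<open>Cantor's intersection theorem replaces the extraction of subsequences: one path of
  \<open>A\<close> meets \<open>B\<close> during every window around \<open>s\<close>. Its meeting
  times converge to \<open>s\<close>, and closedness of \<open>B\<close> gives the value at
  \<open>s\<close>.\<close>

lemma compactin_eval_limit:
  fixes B :: "'a::metric_space set"
  assumes A: "compactin unit_path_topology A" and B: "closed B" and s: "s \<in> {0..<1}"
    and near: "\<And>\<delta>. 0 < \<delta> \<Longrightarrow> \<exists>w\<in>A. \<exists>r\<in>{0..<1}. \<bar>r - s\<bar> \<le> \<delta> \<and> the (w r) \<in> B"
  obtains w where "w \<in> A" "the (w s) \<in> B"
proof -
  \<comment> \<open>With \<open>n + 2\<close> instead of \<open>n + 1\<close> the bound
    \<open>\<delta> n < 1 - s\<close> is strict already for \<open>n = 0\<close>, so every window is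
    a compact part of \<open>[0,1)\<close>.\<close>
  define \<delta> where "\<delta> n = (1 - s) / real (n + 2)" for n
  let ?J = "\<lambda>n. {max 0 (s - \<delta> n)..s + \<delta> n}"
  let ?C = "\<lambda>n. {w \<in> paths {0..<1}. \<exists>r\<in>?J n. the (w r) \<in> B}"
  have A_paths: "A \<subseteq> paths {0..<1}" using compactin_subset_topspace[OF A] by simp
  have \<delta>_pos: "0 < \<delta> n" for n using s by (simp add: \<delta>_def)
  have "(1 - s) * 1 < (1 - s) * real (n + 2)" for n
    using s by (intro mult_strict_left_mono) auto
  then have \<delta>_less: "\<delta> n < 1 - s" for n by (simp add: \<delta>_def pos_divide_less_eq)
  have J_sub: "?J n \<subseteq> {0..<1}" for n
    using \<delta>_less[of n] by auto
  have \<delta>_mono: "\<delta> n \<le> \<delta> m" if "m \<le> n" for m n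
    unfolding \<delta>_def using s that by (intro divide_left_mono) auto
  obtain w where w: "w \<in> A" "\<And>n. w \<in> ?C n"
  proof (rule compactin_decseq_meets[OF A, of ?C])
    show "closedin unit_path_topology (?C n)" for n
      by (rule closedin_compact_open_meets[OF compact_Icc J_sub B])
    have "?J n \<subseteq> ?J m" if "m \<le> n" for m n using \<delta>_mono[OF that] by auto
    then show "decseq ?C" unfolding decseq_def by blast
    show "A \<inter> ?C n \<noteq> {}" for n
    proof -
      obtain w r where "w \<in> A" "r \<in> {0..<1}" "\<bar>r - s\<bar> \<le> \<delta> n" "the (w r) \<in> B"
        using near[OF \<delta>_pos] by blast
      then have "w \<in> A \<inter> ?C n" using A_paths by (auto intro!: bexI[of _ r])
      then show ?thesis by blast
    qed
  qed auto
  then have wp: "continuous_on {0..<1} (\<lambda>t. the (w t))"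
    using A_paths by (auto simp: paths_def)
  have "\<forall>n. \<exists>r. r \<in> ?J n \<and> the (w r) \<in> B" using w(2) by blast
  then obtain r where r: "\<And>n. r n \<in> ?J n" "\<And>n. the (w (r n)) \<in> B" by metis
  have "\<delta> \<longlonglongrightarrow> 0"
    using LIMSEQ_ignore_initial_segment[OF lim_const_over_n[of "1 - s"], of 2]
    by (simp add: \<delta>_def[abs_def])
  have "r \<longlonglongrightarrow> s"
  proof (rule LIM_zero_cancel, rule Lim_null_comparison[OF _ \<open>\<delta> \<longlonglongrightarrow> 0\<close>])
    show "\<forall>\<^sub>F n in sequentially. norm (r n - s) \<le> \<delta> n"
      using r(1) by (intro always_eventually allI) (auto simp: abs_le_iff algebra_simps)
  qed
  then have "(\<lambda>n. the (w (r n))) \<longlonglongrightarrow> the (w s)"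
    using subsetD[OF J_sub r(1)] s
    by (intro continuous_on_tendsto_compose[OF wp]) (auto intro!: always_eventually)
  then have "the (w s) \<in> B"
    by (rule closed_sequentially[OF B r(2)])
  then show ?thesis using that w(1) by blast
qed

text \<open>The distance between the paths is continuous, hence positive near a time
  \<open>t\<close> of disagreement. The rational is taken to the right of \<open>t\<close>, where
  the half-open interval always leaves room.\<close>

lemma paths_differ_at_rational:
  fixes u v :: "'a::metric_space path"
  assumes "u \<in> paths {c..<d}" "v \<in> paths {c..<d}" "u \<noteq> v"
  obtains q where "q \<in> \<rat>" "q \<in> {c..<d}" "the (u q) \<noteq> the (v q)"
proof -
  obtain t where t: "t \<in> {c..<d}" "the (u t) \<noteq> the (v t)" using path_ext assms by metis
  have "continuous_on {c..<d} (\<lambda>t. dist (the (u t)) (the (v t)))"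
    using assms by (auto simp: paths_def intro!: continuous_intros)
  moreover have "0 < dist (the (u t)) (the (v t))" using t by simp
  ultimately obtain e where e: "e > 0" "\<And>r. r \<in> {c..<d} \<Longrightarrow> dist r t < e \<Longrightarrow>
      dist (dist (the (u r)) (the (v r))) (dist (the (u t)) (the (v t)))
        < dist (the (u t)) (the (v t))"
    using t(1) unfolding continuous_on_iff by blast
  obtain q where q: "q \<in> \<rat>" "t < q" "q < min d (t + e)"
    using Rats_dense_in_real[of t "min d (t + e)"] t e by auto
  then have "q \<in> {c..<d}" using t by auto
  moreover have "the (u q) \<noteq> the (v q)"
    using e(2)[OF \<open>q \<in> {c..<d}\<close>] q by (auto simp: dist_real_def)
  ultimately show ?thesis using that q(1) by blast
qed

subsection \<open>Refining a family of funnels\<close>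

text \<open>If \<open>q\<close> is outside the life span of the paths, then \<open>w q = None\<close> and nothing changes.\<close>

definition favour ::
    "real \<Rightarrow> 'a set \<Rightarrow> (real \<Rightarrow> 'a \<Rightarrow> 'a path set) \<Rightarrow> real \<Rightarrow> 'a \<Rightarrow> 'a path set" where
  "favour q B S t0 a = (let P = {w \<in> S t0 a. w q \<in> Some ` B} in if P = {} then S t0 a else P)"

lemma favour_subset: "favour q B S t0 a \<subseteq> S t0 a"
  by (auto simp: favour_def Let_def)

lemma favour_iff:
  "w \<in> favour q B S t0 a \<longleftrightarrow>
    w \<in> S t0 a \<and> ((\<exists>v\<in>S t0 a. v q \<in> Some ` B) \<longrightarrow> w q \<in> Some ` B)"
  by (auto simp: favour_def Let_def)

context abstract_local_integral_funnels
begin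

section \<open>Measurability of the set of initial points whose funnel can answer yes\<close>

text \<open>Lower semicontinuity along a constant initial time makes the sublevel sets
  closed.\<close>

lemma borel_measurable_terminal_time:
  assumes "0 \<le> t0"
  shows "T t0 \<in> borel_measurable borel"
proof -
  have "closed {a. T t0 a \<le> c}" for c
    unfolding closed_sequential_limits
  proof clarify
    fix x a assume x: "\<forall>n. x n \<in> {a. T t0 a \<le> c}" "x \<longlonglongrightarrow> a"
    have "ereal (T t0 a) \<le> liminf (\<lambda>n. ereal (T t0 (x n)))"
      by (rule TT[OF assms assms tendsto_Pair[OF tendsto_const x(2)]])
    also have "\<dots> \<le> ereal c"
      using x(1) by (intro Liminf_le) auto
    finally show "T t0 a \<le> c" by simp
  qed
  then show ?thesis
    by (subst borel_measurable_iff_le) (auto intro!: borel_closed)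
qed

text \<open>A path has value \<open>None\<close> outside its life span, so the lifted membership
  tests survival and value at once.\<close>

lemma path_value_in_iff:
  assumes "0 \<le> t0" "w \<in> S t0 a"
  shows "w q \<in> Some ` B \<longleftrightarrow> q \<in> {t0..<t0 + T t0 a} \<and> the (w q) \<in> B"
proof -
  have "w \<in> paths {t0..<t0 + T t0 a}" using S_paths assms by blast
  then have "dom w = {t0..<t0 + T t0 a}" by (simp add: paths_def)
  then have "w q \<noteq> None \<longleftrightarrow> q \<in> {t0..<t0 + T t0 a}" by (metis domIff)
  then show ?thesis by (cases "w q") auto
qed

text \<open>
  In unit time the question is asked at \<open>(q - t0) / T t0 a\<close>, which varies with \<open>a\<close>.  It is
  enclosed in small rational intervals, on which the set of paths meeting \<open>B\<close> is closed and
  independent of \<open>a\<close>; compactness of the funnels permits the passage to the limit.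
\<close>

lemma measurable_meets_at_time:
  assumes t0: "0 \<le> t0" and F: "closedin unit_path_topology F" and B: "closed B"
  shows "{a. \<exists>w\<in>S t0 a. reparam t0 (T t0 a) w \<in> F \<and> w q \<in> Some ` B} \<in> sets borel"
    (is "?D \<in> _")
proof (cases "t0 \<le> q")
  case False
  then have "?D = {}" using path_value_in_iff[OF t0] by auto
  then show ?thesis by (simp only: sets.empty_sets)
next
  case True
  define s where "s a = (q - t0) / T t0 a" for a
  note [measurable] = borel_measurable_terminal_time[OF t0]
  have s_meas [measurable]: "s \<in> borel_measurable borel" unfolding s_def by measurable
  have s_ge: "0 \<le> s a" for a using True T_pos[OF t0] by (simp add: s_def less_imp_le)
  have s_less: "s a < 1 \<longleftrightarrow> q \<in> {t0..<t0 + T t0 a}" for a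
    using True T_pos[OF t0, of a] by (auto simp: s_def field_simps)
  \<comment> \<open>Building \<open>F\<close> into the compact set \<open>R a\<close> ensures that
    the limit path found in it still lies in \<open>F\<close>.\<close>
  define R where "R a = reparam t0 (T t0 a) ` S t0 a \<inter> F" for a
  have R_compact: "compactin unit_path_topology (R a)" for a
    unfolding R_def
    using image_compactin[OF LS1_compact[OF t0] continuous_map_reparam[OF T_pos[OF t0]]] F
    by (rule compact_Int_closedin)
  have D_eq: "a \<in> ?D \<longleftrightarrow> s a < 1 \<and> (\<exists>w\<in>R a. the (w (s a)) \<in> B)" for a
  proof -
    have *: "w q \<in> Some ` B \<longleftrightarrow> s a < 1 \<and> the (reparam t0 (T t0 a) w (s a)) \<in> B"
      if "w \<in> S t0 a" for w
    proof (cases "s a < 1")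
      case True
      then have "reparam t0 (T t0 a) w (s a) = w q"
        unfolding s_def using reparam_eq[OF T_pos[OF t0]] s_less by (simp add: s_def)
      then show ?thesis using True path_value_in_iff[OF t0 that] s_less by simp
    next
      case False
      then show ?thesis using path_value_in_iff[OF t0 that] s_less by blast
    qed
    show ?thesis unfolding R_def using * by auto
  qed
  let ?E = "\<lambda>\<alpha> \<beta>. {w \<in> paths {0..<1}. \<exists>r\<in>{max 0 \<alpha>..\<beta>}. the (w r) \<in> B}"
  \<comment> \<open>Rational end points keep the union countable; \<open>\<beta> < 1\<close> keeps
    the window inside \<open>[0,1)\<close> and forces \<open>s a < 1\<close>, that is,
    \<open>q\<close> lies in the life span.\<close>
  let ?Q = "\<lambda>n. {(\<alpha>, \<beta>). \<alpha> \<in> \<rat> \<and> \<beta> \<in> \<rat> \<and> \<beta> < 1 \<and> \<beta> - \<alpha> \<le> 1 / real (Suc n)}"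
  let ?G = "\<lambda>(\<alpha>, \<beta>). {a. \<alpha> \<le> s a \<and> s a \<le> \<beta>} \<inter> {a. R a \<inter> ?E \<alpha> \<beta> \<noteq> {}}"
  have "?D = (\<Inter>n. \<Union>p\<in>?Q n. ?G p)"
  proof (intro equalityI subsetI)
    fix a assume "a \<in> ?D"
    then obtain w where w: "s a < 1" "w \<in> R a" "the (w (s a)) \<in> B" using D_eq by blast
    have wp: "w \<in> paths {0..<1}" using w(2) compactin_subset_topspace[OF R_compact] by auto
    show "a \<in> (\<Inter>n. \<Union>p\<in>?Q n. ?G p)"
    proof
      fix n
      \<comment> \<open>Each end point is chosen within half the permitted width of
        \<open>s a\<close>.\<close>
      obtain \<alpha> where \<alpha>: "\<alpha> \<in> \<rat>" "s a - 1 / (2 * real (Suc n)) < \<alpha>" "\<alpha> < s a"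
        using Rats_dense_in_real[of "s a - 1 / (2 * real (Suc n))" "s a"] by auto
      obtain \<beta> where \<beta>: "\<beta> \<in> \<rat>" "s a < \<beta>" "\<beta> < min 1 (s a + 1 / (2 * real (Suc n)))"
        using Rats_dense_in_real[of "s a" "min 1 (s a + 1 / (2 * real (Suc n)))"] w(1) by auto
      have "1 / (2 * real (Suc n)) + 1 / (2 * real (Suc n)) = 1 / real (Suc n)"
        by (simp add: field_simps)
      then have "(\<alpha>, \<beta>) \<in> ?Q n" using \<alpha> \<beta> by auto
      moreover have "w \<in> R a \<inter> ?E \<alpha> \<beta>"
        using w wp \<alpha> \<beta> s_ge[of a] by (auto intro!: bexI[of _ "s a"])
      then have "a \<in> ?G (\<alpha>, \<beta>)" using \<alpha> \<beta> by auto
      ultimately show "a \<in> (\<Union>p\<in>?Q n. ?G p)" by (rule UN_I)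
    qed
  next
    fix a assume a: "a \<in> (\<Inter>n. \<Union>p\<in>?Q n. ?G p)"
    have ex: "\<exists>\<alpha> \<beta> w r. \<beta> < 1 \<and> \<beta> - \<alpha> \<le> 1 / real (Suc n) \<and> \<alpha> \<le> s a \<and> s a \<le> \<beta> \<and>
        w \<in> R a \<and> max 0 \<alpha> \<le> r \<and> r \<le> \<beta> \<and> the (w r) \<in> B" for n
      using INT_D[OF a, of n] by fastforce
    have s1: "s a < 1" using ex[of 0] by auto
    obtain w where "w \<in> R a" "the (w (s a)) \<in> B"
    proof (rule compactin_eval_limit[OF R_compact B])
      show "s a \<in> {0..<1}" using s1 s_ge by simp
      fix \<delta> :: real
      assume "0 < \<delta>"
      then obtain n where n: "1 / real (Suc n) < \<delta>"
        using nat_approx_posE by metis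
      obtain \<alpha> \<beta> w r where "\<beta> < 1" "\<beta> - \<alpha> \<le> 1 / real (Suc n)" "\<alpha> \<le> s a" "s a \<le> \<beta>"
        "w \<in> R a" "max 0 \<alpha> \<le> r" "r \<le> \<beta>" "the (w r) \<in> B"
        using ex[of n] by blast
      then show "\<exists>w\<in>R a. \<exists>r\<in>{0..<1}. \<bar>r - s a\<bar> \<le> \<delta> \<and> the (w r) \<in> B"
        using n by (intro bexI[of _ w] bexI[of _ r]) auto
    qed auto
    then show "a \<in> ?D" using D_eq s1 by blast
  qed
  also have "\<dots> \<in> sets borel"
  proof -
    have "countable (?Q n)" for n
      by (rule countable_subset[of _ "\<rat> \<times> \<rat>"]) (auto intro: countable_SIGMA countable_rat)
    moreover have "?G p \<in> sets borel" if "p \<in> ?Q n" for n p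
    proof -
      obtain \<alpha> \<beta> where p: "p = (\<alpha>, \<beta>)" "\<beta> < 1" using \<open>p \<in> ?Q n\<close> by auto
      have "closedin unit_path_topology (?E \<alpha> \<beta>)"
        by (rule closedin_compact_open_meets) (use p B in auto)
      then have "closedin unit_path_topology (F \<inter> ?E \<alpha> \<beta>)" using F by blast
      from LS2[OF t0 this] have "{a. R a \<inter> ?E \<alpha> \<beta> \<noteq> {}} \<in> sets borel"
        by (simp add: R_def Int_assoc)
      moreover have "{a. \<alpha> \<le> s a \<and> s a \<le> \<beta>} \<in> sets borel" by measurable
      ultimately show ?thesis unfolding p by auto
    qed
    ultimately have "(\<Union>p\<in>?Q n. ?G p) \<in> sets borel" for n
      by (intro sets.countable_UN') blast+
    then show ?thesis by (intro sets.countable_INT) auto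
  qed
  finally show ?thesis .
qed

text \<open>Compactness survives because the question is a closed condition, and measurability by
  distinguishing whether yes is available. Shifts and splices survive because the question concerns
  an absolute time: attaching or cutting off an earlier piece does not change the answer at a later
  one.\<close>

lemma favour_funnels:
  assumes B: "closed B"
  shows "abstract_local_integral_funnels T (favour q B S)"
proof
  fix t0 :: real and a :: 'a
  assume t0: "0 \<le> t0"
  let ?I = "{t0..<t0 + T t0 a}"
  show "0 < T t0 a" using t0 by (rule T_pos)
  show "favour q B S t0 a \<subseteq> paths ?I"
    by (rule subset_trans[OF favour_subset]) (rule S_paths[OF t0])
  show "favour q B S t0 a \<noteq> {}"
    using LS1_nonempty[OF t0] by (auto simp: favour_def Let_def)
  show "compactin (locally_uniform_topology ?I) (favour q B S t0 a)"
  proof (cases "\<exists>v\<in>S t0 a. v q \<in> Some ` B")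
    case False
    then have "favour q B S t0 a = S t0 a" by (auto simp: favour_iff)
    then show ?thesis using LS1_compact[OF t0] by simp
  next
    case True
    then have q: "q \<in> ?I" using path_value_in_iff[OF t0] by blast
    have "favour q B S t0 a = S t0 a \<inter> {w \<in> paths ?I. the (w q) \<in> B}"
      using True q path_value_in_iff[OF t0] subsetD[OF S_paths[OF t0]] by (auto simp: favour_iff)
    then show ?thesis
      using compact_Int_closedin[OF LS1_compact[OF t0] closedin_locally_uniform_eval[OF q B]]
      by simp
  qed
  show "w t0 = Some a" if "w \<in> favour q B S t0 a" for w
    by (rule LS1_initial[OF t0 subsetD[OF favour_subset that]])
next
  fix t :: "nat \<Rightarrow> real" and x t0 a
  assume "\<And>n. 0 \<le> t n" "0 \<le> t0" "(\<lambda>n. (t n, x n)) \<longlonglongrightarrow> (t0, a :: 'a)"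
  then show "ereal (T t0 a) \<le> liminf (\<lambda>n. ereal (T (t n) (x n)))" by (rule TT)
next
  fix t0 :: real and F
  assume t0: "0 \<le> t0" and F: "closedin unit_path_topology (F :: 'a path set)"
  let ?D = "\<lambda>F. {a. \<exists>w\<in>S t0 a. reparam t0 (T t0 a) w \<in> F \<and> w q \<in> Some ` B}"
  let ?A = "{a. reparam t0 (T t0 a) ` S t0 a \<inter> F \<noteq> {}}"
  have top: "reparam t0 (T t0 a) w \<in> paths {0..<1}" if "w \<in> S t0 a" for a w
    using reparam_in_paths[OF T_pos[OF t0]] S_paths[OF t0] that by blast
  \<comment> \<open>Either some path in \<open>F\<close> answers yes, or some path lies in
    \<open>F\<close> and no path of the funnel answers yes. Availability of yes is \<open>?D\<close>
    for the whole path space.\<close>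
  have "{a. reparam t0 (T t0 a) ` favour q B S t0 a \<inter> F \<noteq> {}}
      = ?D F \<union> (?A - ?D (paths {0..<1}))"
  proof (rule set_eqI)
    fix a
    have D_top: "a \<in> ?D (paths {0..<1}) \<longleftrightarrow> (\<exists>w\<in>S t0 a. w q \<in> Some ` B)"
      using top[of _ a] by blast
    have "(\<exists>w\<in>favour q B S t0 a. reparam t0 (T t0 a) w \<in> F) \<longleftrightarrow>
        (\<exists>w\<in>S t0 a. reparam t0 (T t0 a) w \<in> F \<and> w q \<in> Some ` B)
        \<or> (\<exists>w\<in>S t0 a. reparam t0 (T t0 a) w \<in> F) \<and> \<not> (\<exists>w\<in>S t0 a. w q \<in> Some ` B)"
      unfolding favour_iff Bex_def by blast
    then show "a \<in> {a. reparam t0 (T t0 a) ` favour q B S t0 a \<inter> F \<noteq> {}}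
        \<longleftrightarrow> a \<in> ?D F \<union> (?A - ?D (paths {0..<1}))"
      unfolding Un_iff Diff_iff D_top by blast
  qed
  moreover have "closedin unit_path_topology (paths {0..<1} :: 'a path set)"
    using closedin_topspace[of "unit_path_topology :: 'a path topology"] by simp
  ultimately show "{a. reparam t0 (T t0 a) ` favour q B S t0 a \<inter> F \<noteq> {}} \<in> sets borel"
    using LS2[OF t0 F] measurable_meets_at_time[OF t0 _ B] F
    by (auto intro!: sets.Un sets.Diff)
next
  fix t0 a u \<tau>
  assume h: "0 \<le> t0" "u \<in> favour q B S t0 a" "0 \<le> \<tau>" "\<tau> < T t0 a"
  have u: "u \<in> S t0 a" by (rule subsetD[OF favour_subset h(2)])
  have u_paths: "u \<in> paths {t0..<t0 + T t0 a}" by (rule subsetD[OF S_paths[OF h(1)] u])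
  let ?t1 = "t0 + \<tau>"
  let ?b = "the (u ?t1)"
  let ?\<sigma> = "u |` {?t1..<t0 + T t0 a}"
  have t1: "0 \<le> ?t1" using h by simp
  have "?t1 \<in> dom u" using u_paths h(3,4) by (simp add: paths_def)
  then have ub: "u ?t1 = Some ?b" by auto
  have \<sigma>: "?\<sigma> \<in> S ?t1 ?b" by (rule LS3_shift[OF h(1) u h(3,4)])
  show "T t0 a - \<tau> \<le> T ?t1 ?b" by (rule LS3_time[OF h(1) u h(3,4)])
  \<comment> \<open>The domain of \<open>?\<sigma>\<close> is read off twice, from the restriction
    and from the funnel containing it, so the end times agree.\<close>
  have T_eq: "?t1 + T ?t1 ?b = t0 + T t0 a"
  proof -
    have "dom ?\<sigma> = {?t1..<t0 + T t0 a}"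
      using u_paths h(3) by (auto simp: paths_def)
    moreover have "dom ?\<sigma> = {?t1..<?t1 + T ?t1 ?b}"
      using subsetD[OF S_paths[OF t1] \<sigma>] by (auto simp: paths_def)
    ultimately show ?thesis
      using T_pos[OF t1, of ?b] h(4) by (auto simp: atLeastLessThan_eq_iff)
  qed
  \<comment> \<open>If some continuation answers yes, then so does its splice with \<open>u\<close>, hence so does \<open>u\<close>.\<close>
  have late: "u q \<in> Some ` B" if v: "v \<in> S ?t1 ?b" "v q \<in> Some ` B" for v
  proof -
    have "?t1 \<le> q" using path_value_in_iff[OF t1 v(1)] v(2) by auto
    \<comment> \<open>At \<open>q = ?t1\<close> the splice takes the value of \<open>u\<close>,
      which is also the initial value of \<open>v\<close>.\<close>
    then have "splice u ?t1 v q = v q"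
      using ub LS1_initial[OF t1 v(1)] by (cases "q = ?t1") (auto simp: splice_def)
    then show ?thesis
      using LS4[OF h(1) u h(3,4) v(1)] h(2) v(2) unfolding favour_iff by metis
  qed
  show "?\<sigma> \<in> favour q B S ?t1 ?b"
    unfolding favour_iff
  proof (intro conjI \<sigma> impI)
    assume "\<exists>v\<in>S ?t1 ?b. v q \<in> Some ` B"
    then obtain v where v: "v \<in> S ?t1 ?b" "v q \<in> Some ` B" by blast
    then have "q \<in> {?t1..<t0 + T t0 a}" using path_value_in_iff[OF t1 v(1)] T_eq by auto
    then show "?\<sigma> q \<in> Some ` B" using late[OF v] by simp
  qed
  fix v assume v': "v \<in> favour q B S ?t1 ?b"
  then have v: "v \<in> S ?t1 ?b" by (rule subsetD[OF favour_subset])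
  show "splice u ?t1 v \<in> favour q B S t0 a"
    unfolding favour_iff
  proof (intro conjI impI)
    show "splice u ?t1 v \<in> S t0 a" by (rule LS4[OF h(1) u h(3,4) v])
    assume "\<exists>v\<in>S t0 a. v q \<in> Some ` B"
    then have uq: "u q \<in> Some ` B" using h(2) by (simp add: favour_iff)
    show "splice u ?t1 v q \<in> Some ` B"
    \<comment> \<open>Up to \<open>?t1\<close> the splice keeps the answer of \<open>u\<close>.
      Later, \<open>?\<sigma>\<close> inherits the yes of \<open>u\<close>, so yes is available in
      the funnel at \<open>?t1\<close> and the favoured path \<open>v\<close> must answer
      yes.\<close>
    proof (cases "q \<le> ?t1")
      case True
      then show ?thesis using uq by (simp add: splice_def)
    next
      case False
      then have "?\<sigma> q = u q" using path_value_in_iff[OF h(1) u] uq by auto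
      then have "v q \<in> Some ` B" using \<sigma> uq v' unfolding favour_iff by metis
      then show ?thesis using False by (simp add: splice_def)
    qed
  qed
qed

end

subsection \<open>Iterated refinement\<close>

primrec refine ::
    "(nat \<Rightarrow> real \<times> 'a set) \<Rightarrow> (real \<Rightarrow> 'a \<Rightarrow> 'a path set) \<Rightarrow> nat \<Rightarrow> real \<Rightarrow> 'a \<Rightarrow> 'a path set"
where
  "refine e S 0 = S"
| "refine e S (Suc n) = favour (fst (e n)) (snd (e n)) (refine e S n)"

lemma decseq_refine: "decseq (\<lambda>n. refine e S n t0 a)"
  by (rule decseq_SucI) (simp add: favour_subset)

context abstract_local_integral_funnels
begin

lemma refine_funnels:
  assumes "\<And>n. closed (snd (e n))"
  shows "abstract_local_integral_funnels T (refine e S n)"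
proof (induction n)
  case 0
  show ?case by (simp add: abstract_local_integral_funnels_axioms)
next
  case (Suc n)
  show ?case
    unfolding refine.simps
    by (rule abstract_local_integral_funnels.favour_funnels[OF Suc.IH assms])
qed

text \<open>Pulled back along \<open>reparam\<close>, \<open>F\<close> cuts the refined funnels down
  to decreasing closed sets that all meet the compact \<open>S t0 a\<close>, so they share a path.
  The whole space as \<open>F\<close> gives a path surviving all questions; general \<open>F\<close>
  gives measurability of the selection.\<close>

lemma refine_meets:
  assumes e: "\<And>n. closed (snd (e n))" and t0: "0 \<le> t0"
    and F: "closedin unit_path_topology F"
    and meets: "\<And>n. reparam t0 (T t0 a) ` refine e S n t0 a \<inter> F \<noteq> {}"
  obtains w where "\<And>n. w \<in> refine e S n t0 a" "reparam t0 (T t0 a) w \<in> F"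
proof -
  let ?I = "{t0..<t0 + T t0 a}"
  let ?F = "{w \<in> paths ?I. reparam t0 (T t0 a) w \<in> F}"
  let ?C = "\<lambda>n. refine e S n t0 a \<inter> ?F"
  have sub: "refine e S n t0 a \<subseteq> paths ?I" for n
    using abstract_local_integral_funnels.S_paths[OF refine_funnels[OF e] t0] .
  have "closedin (locally_uniform_topology ?I) ?F"
    using closedin_continuous_map_preimage[OF continuous_map_reparam[OF T_pos[OF t0]] F] by simp
  moreover have "closedin (locally_uniform_topology ?I) (refine e S n t0 a)" for n
    using compactin_imp_closedin[OF Hausdorff_locally_uniform_topology]
      abstract_local_integral_funnels.LS1_compact[OF refine_funnels[OF e] t0] .
  ultimately have closed: "closedin (locally_uniform_topology ?I) (?C n)" for n by blast
  have dec: "decseq ?C" using decseq_refine[of e S t0 a] by (auto simp: decseq_def)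
  have ne: "S t0 a \<inter> ?C n \<noteq> {}" for n
  proof -
    have "refine e S n t0 a \<subseteq> S t0 a" using decseqD[OF decseq_refine, of 0 n e S t0 a] by simp
    then show ?thesis using meets[of n] sub[of n] by blast
  qed
  show ?thesis
    by (rule compactin_decseq_meets[OF LS1_compact[OF t0] closed dec ne]) (use that in auto)
qed

text \<open>Distinct paths differ at a rational \<open>q\<close>, and some basic open
  \<open>U\<close> contains the value of \<open>u\<close> there but not that of \<open>v\<close>.
  When the question \<open>(q, - U)\<close> is asked, \<open>v\<close> shows that yes is available,
  while \<open>u\<close> answers no and would be discarded.\<close>

lemma refine_unique:
  assumes e: "range e = \<rat> \<times> uminus ` \<B>" and \<B>: "topological_basis \<B>"
    and t0: "0 \<le> t0"
    and u: "\<And>n. u \<in> refine e S n t0 a" and v: "\<And>n. v \<in> refine e S n t0 a"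
  shows "u = v"
proof (rule ccontr)
  assume "u \<noteq> v"
  have uS: "u \<in> S t0 a" "v \<in> S t0 a" using u[of 0] v[of 0] by auto
  then obtain q where q: "q \<in> \<rat>" "q \<in> {t0..<t0 + T t0 a}" "the (u q) \<noteq> the (v q)"
    using paths_differ_at_rational[OF subsetD[OF S_paths[OF t0]] subsetD[OF S_paths[OF t0]]]
      \<open>u \<noteq> v\<close> by metis
  then obtain U where U: "U \<in> \<B>" "the (u q) \<in> U" "the (v q) \<notin> U"
    using topological_basisE[OF \<B>, of "- {the (v q)}" "the (u q)"] by auto
  then obtain n where n: "e n = (q, - U)"
    using e q(1) by (metis (no_types, lifting) SigmaI imageE imageI)
  have "v q \<in> Some ` (- U)" "u q \<notin> Some ` (- U)"
    using path_value_in_iff[OF t0] uS q U by auto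
  moreover have "u \<in> favour q (- U) (refine e S n) t0 a" using u[of "Suc n"] n by simp
  ultimately show False using v[of n] unfolding favour_iff by blast
qed

end

section \<open>The surviving paths as a measurable selection with the semigroup property\<close>

theorem theorem2:
  fixes T :: "real \<Rightarrow> 'a::polish_space \<Rightarrow> real"
    and S :: "real \<Rightarrow> 'a \<Rightarrow> 'a path set"
  assumes bounded: "\<And>x y :: 'a. dist x y \<le> 1"
    and funnels: "abstract_local_integral_funnels T S"
  shows "\<exists>\<uu> :: real \<Rightarrow> 'a \<Rightarrow> 'a path.
      (\<forall>t0\<ge>0. \<forall>a. \<uu> t0 a \<in> S t0 a) \<and>
      (\<forall>t0\<ge>0. (\<lambda>a. reparam t0 (T t0 a) (\<uu> t0 a)) \<in> borel \<rightarrow>\<^sub>M unit_path_borel) \<and>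
      (\<forall>t0\<ge>0. \<forall>a. \<uu> t0 a t0 = Some a) \<and>
      (\<forall>t0\<ge>0. \<forall>a. \<forall>t1\<in>{t0..<t0 + T t0 a}. \<forall>t2\<in>{t1..<t0 + T t0 a}.
         \<uu> t1 (the (\<uu> t0 a t1)) t2 = \<uu> t0 a t2)"
proof -
  interpret abstract_local_integral_funnels T S by (rule funnels)
  obtain \<B> :: "'a set set" where \<B>: "countable \<B>" "topological_basis \<B>"
    using ex_countable_basis by blast
  \<comment> \<open>A sequence whose range is exactly the set of questions requires that set to be
    non-empty; repeated questions are harmless.\<close>
  have "\<B> \<noteq> {}"
    using topological_basisE[OF \<B>(2) open_UNIV UNIV_I] by (metis empty_iff)
  moreover have "\<rat> \<noteq> ({} :: real set)" using Rats_0 by blast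
  ultimately have "\<rat> \<times> uminus ` \<B> \<noteq> ({} :: (real \<times> 'a set) set)" by blast
  moreover have "countable (\<rat> \<times> uminus ` \<B> :: (real \<times> 'a set) set)"
    by (intro countable_SIGMA countable_rat countable_image \<B>(1))
  ultimately obtain e :: "nat \<Rightarrow> real \<times> 'a set" where e: "range e = \<rat> \<times> uminus ` \<B>"
    using range_from_nat_into by metis
  have e_closed: "closed (snd (e n))" for n
  proof -
    have "e n \<in> \<rat> \<times> uminus ` \<B>" using e by blast
    then show ?thesis using topological_basis_open[OF \<B>(2)] by (auto simp: closed_Compl)
  qed
  have fam: "abstract_local_integral_funnels T (refine e S n)" for n
    by (rule refine_funnels[OF e_closed])
  note unique = refine_unique[OF e \<B>(2)]
  have reparam_top: "reparam t0 (T t0 a) w \<in> paths {0..<1}" if "0 \<le> t0" "w \<in> S t0 a" for t0 a w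
    using reparam_in_paths[OF T_pos] S_paths that by blast
  have "\<exists>w. \<forall>n. w \<in> refine e S n t0 a" if t0: "0 \<le> t0" for t0 a
  \<comment> \<open>For the whole path space, meeting \<open>F\<close> just means that the refined
    funnels are non-empty.\<close>
  proof (rule refine_meets[where e = e and F = "paths {0..<1}" and a = a, OF e_closed t0])
    show "closedin unit_path_topology (paths {0..<1} :: 'a path set)"
      using closedin_topspace[of "unit_path_topology :: 'a path topology"] by simp
    show "reparam t0 (T t0 a) ` refine e S n t0 a \<inter> paths {0..<1} \<noteq> {}" for n
    proof -
      obtain w where w: "w \<in> refine e S n t0 a"
        using abstract_local_integral_funnels.LS1_nonempty[OF fam t0] by blast
      have "w \<in> S t0 a" using w decseqD[OF decseq_refine, of 0 n e S t0 a] by auto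
      then show ?thesis using w reparam_top[OF t0] by blast
    qed
  qed auto
  then obtain \<uu> where \<uu>: "\<And>t0 a n. 0 \<le> t0 \<Longrightarrow> \<uu> t0 a \<in> refine e S n t0 a" by metis
  have \<uu>_S: "\<uu> t0 a \<in> S t0 a" if "0 \<le> t0" for t0 a using \<uu>[OF that, of a 0] by simp
  show ?thesis
  proof (intro exI[of _ \<uu>] conjI allI impI ballI)
    fix t0 :: real assume t0: "0 \<le> t0"
    let ?R = "\<lambda>a. reparam t0 (T t0 a) (\<uu> t0 a)"
    show "\<uu> t0 a \<in> S t0 a" for a by (rule \<uu>_S[OF t0])
    show "\<uu> t0 a t0 = Some a" for a by (rule LS1_initial[OF t0 \<uu>_S[OF t0]])
    have closed_meas: "{a. ?R a \<in> F} \<in> sets borel" if F: "closedin unit_path_topology F" for F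
    proof -
      \<comment> \<open>If all refined funnels at \<open>a\<close> meet \<open>F\<close>, some path
        surviving all questions lies in \<open>F\<close>, and by uniqueness it is
        \<open>\<uu> t0 a\<close>. The preimage of \<open>F\<close> thus is a countable intersection
        of sets that are measurable by \<open>LS2\<close>.\<close>
      have "{a. ?R a \<in> F} = (\<Inter>n. {a. reparam t0 (T t0 a) ` refine e S n t0 a \<inter> F \<noteq> {}})"
      proof (intro equalityI subsetI)
        fix a assume a: "a \<in> (\<Inter>n. {a. reparam t0 (T t0 a) ` refine e S n t0 a \<inter> F \<noteq> {}})"
        obtain w where "\<And>n. w \<in> refine e S n t0 a" "reparam t0 (T t0 a) w \<in> F"
          by (rule refine_meets[where e = e and a = a, OF e_closed t0 F]) (use a in auto)
        then show "a \<in> {a. ?R a \<in> F}" using unique[OF t0 _ \<uu>[OF t0]] by auto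
      qed (use \<uu>[OF t0] in blast)
      then show ?thesis
        using abstract_local_integral_funnels.LS2[OF fam t0 F] by auto
    qed
    show "?R \<in> borel \<rightarrow>\<^sub>M unit_path_borel"
      unfolding unit_path_borel_def
    proof (rule measurable_measure_of)
      show "{U. openin unit_path_topology U} \<subseteq> Pow (topspace (unit_path_topology :: 'a path topology))"
        using openin_subset by blast
      show "?R \<in> space borel \<rightarrow> topspace unit_path_topology"
        using reparam_top[OF t0 \<uu>_S[OF t0]] by simp
      fix U :: "'a path set" assume "U \<in> {U. openin unit_path_topology U}"
      then have "closedin unit_path_topology (topspace unit_path_topology - U)" by blast
      from closed_meas[OF this] have "- {a. ?R a \<in> topspace unit_path_topology - U} \<in> sets borel"
        by (rule borel_comp)
      moreover have "?R -` U \<inter> space borel = - {a. ?R a \<in> topspace unit_path_topology - U}"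
        using reparam_top[OF t0 \<uu>_S[OF t0]] by auto
      ultimately show "?R -` U \<inter> space borel \<in> sets borel" by simp
    qed
    fix a t1 t2 assume t1: "t1 \<in> {t0..<t0 + T t0 a}" and t2: "t2 \<in> {t1..<t0 + T t0 a}"
    let ?b = "the (\<uu> t0 a t1)"
    \<comment> \<open>The shift axiom holds for every refined family, so the tail of the selected
      path lies in all refined funnels at \<open>(t1, ?b)\<close>; uniqueness identifies it with the
      path selected there.\<close>
    have "\<uu> t0 a |` {t1..<t0 + T t0 a} \<in> refine e S n t1 ?b" for n
      using abstract_local_integral_funnels.LS3_shift[OF fam t0 \<uu>[OF t0], of "t1 - t0" a] t1
      by simp
    moreover have "0 \<le> t1" using t0 t1 by simp
    ultimately have "\<uu> t0 a |` {t1..<t0 + T t0 a} = \<uu> t1 ?b"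
      using unique \<uu> by blast
    then show "\<uu> t1 ?b t2 = \<uu> t0 a t2" using t2 by (metis restrict_in)
  qed
qed

end
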